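(* Let $p\in[1,\infty)$, let $\bm{w}=(w_n:n\in\omega)$ be a bounded sequence of reals with $w_n\ge 1$ for all $n\in\omega$, and consider the weighted backward shift $B_{\bm{w}}$ on $\ell_p$, where $\ell_p$ is endowed with the product topology $\tau^p$. Suppose also that $$\sum_{n\in\omega}\frac{1}{(w_0 w_1\cdots w_n)^p}<\infty.$$ Then $\mathrm{UFHC}(B_{\bm{w}})$ is not an $F_{\sigma\delta}$-subset of $(\ell_p,\tau^p)$. In particular, for all $\lambda>1$, $\mathrm{UFHC}(\lambda B)$ is not a $G_\delta$-subset of $(\ell_p,\tau^p)$.
   Context: $\omega$ is the set of nonnegative integers. $\ell_p$ is the space of real sequences $(x_n:n\in\omega)$ with $\sum_n|x_n|^p<\infty$. The product topology $\tau^p$ on $\ell_p$ is the subspace topology inherited from the product topology of $\mathbf{R}^\omega$. For a weight sequence $\bm{w}$, $B_{\bm{w}}(x_0,x_1,x_2,\ldots):=(w_1x_1,w_2x_2,w_3x_3,\ldots)$; $B$ denotes $B_{\bm{w}}$ for $\bm{w}=(1,1,\ldots)$. For a continuous linear operator $T$ on a topological vector space $X$, $\mathrm{UFHC}(T)$ is the set of upper frequently hypercyclic vectors, i.e. of those $x\in X$ such that $\{n\in\omega:T^nx\in U\}$ has positive upper asymptotic density for every nonempty open $U\subseteq X$, where the upper asymptotic density of $S\subseteq\omega$ is $\limsup_{n\to\infty}|S\cap[0,n)|/(n+1)$. Here openness is with respect to $\tau^p$. An $F_{\sigma\delta}$-set is a countable intersection of $F_\sigma$-sets. *)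

theory Defs
  imports "HOL-Analysis.Analysis"
begin

definition ell :: "real \<Rightarrow> (nat \<Rightarrow> real) set"
  where "ell p = {x. summable (\<lambda>n. \<bar>x n\<bar> powr p)}"

definition ell_prod_topology :: "real \<Rightarrow> (nat \<Rightarrow> real) topology"
  where "ell_prod_topology p =
    subtopology (product_topology (\<lambda>_. euclideanreal) UNIV) (ell p)"

(* The weight w 0 is not used by the operator: the output is (w 1 * x 1, w 2 * x 2, ...).
   For bounded w the operator maps ell p into itself. *)
definition weighted_shift :: "(nat \<Rightarrow> real) \<Rightarrow> (nat \<Rightarrow> real) \<Rightarrow> nat \<Rightarrow> real"
  where "weighted_shift w x = (\<lambda>n. w (Suc n) * x (Suc n))"

definition backward_shift :: "(nat \<Rightarrow> real) \<Rightarrow> nat \<Rightarrow> real"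
  where "backward_shift = weighted_shift (\<lambda>_. 1)"

definition upper_density :: "nat set \<Rightarrow> ereal"
  where "upper_density S = limsup (\<lambda>n. ereal (real (card (S \<inter> {0..<n})) / real (n + 1)))"

(* Meant for operators T that map topspace X into itself; the values of T outside
   topspace X are irrelevant then. *)
definition UFHC :: "'a topology \<Rightarrow> ('a \<Rightarrow> 'a) \<Rightarrow> 'a set"
  where "UFHC X T = {x \<in> topspace X.
    \<forall>U. openin X U \<and> U \<noteq> {} \<longrightarrow> upper_density {n. (T ^^ n) x \<in> U} > 0}"

(* As in the library's gdelta_in, relative_to only makes the empty intersection
   the whole space. *)
definition fsigmadelta_in :: "'a topology \<Rightarrow> 'a set \<Rightarrow> bool"
  where "fsigmadelta_in X = ((countable intersection_of fsigma_in X) relative_to topspace X)"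

end

theory Submission
  imports Defs "HOL-Library.Discrete_Functions"
begin

text \<open>
  By a fusion argument, the sequences of naturals tending to infinity do not form a countable
  union of \<open>G\<^sub>\<delta>\<close> subsets of Baire space, and the complement of this set reduces
  continuously to UFHC. With \<open>P n = w 0 * \<dots> * w n\<close> and \<open>x n = u n / P n\<close> one has
  \<open>(T^n x) i = u (n + i) / P i\<close>, so \<open>x\<close> is upper frequently hypercyclic iff every finite rational
  word is approximated in \<open>u\<close> with positive upper density. Given a sequence \<open>a\<close>, only the first
  \<open>2^(n - a n)\<close> places of the dyadic block from \<open>2^n\<close> to \<open>2^(n+1)\<close> carry words, and
  a fixed positive proportion of these is devoted to each word; all other places are zero.
  Hence every word has positive upper density if \<open>a\<close> is bounded along a subsequence, and the
  support of \<open>u\<close> has density zero if \<open>a\<close> tends to infinity. Entries of \<open>u\<close> larger than a slowly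
  diverging threshold are replaced by zero, which keeps \<open>x\<close> in \<open>\<ell>\<^sub>p\<close> without affecting any density.
\<close>

section \<open>Baire space: sequences tending to infinity\<close>

lemma coherent_limit:
  fixes b :: "nat \<Rightarrow> nat \<Rightarrow> 'a" and N :: "nat \<Rightarrow> nat"
  assumes N: "\<And>j. N j < N (Suc j)"
    and b: "\<And>j i. i < N j \<Longrightarrow> b (Suc j) i = b j i"
  obtains d where "\<And>j i. i < N j \<Longrightarrow> d i = b j i"
proof -
  have mono: "strict_mono N"
    using N by (simp add: strict_mono_Suc_iff)
  have stable: "b (j + k) i = b j i" if "i < N j" for i j k
  proof (induction k)
    case (Suc k)
    have "N j \<le> N (j + k)"
      using mono by (simp add: strict_mono_less_eq)
    then show ?case
      using Suc b[of i "j + k"] that by simp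
  qed simp
  \<comment> \<open>Strict monotonicity gives \<open>i < N (Suc i)\<close>, so coordinate
    \<open>i\<close> is frozen from stage \<open>Suc i\<close> on and the diagonal is the
    limit.\<close>
  have "b (Suc i) i = b j i" if "i < N j" for i j
  proof (cases "j \<le> Suc i")
    case True
    then show ?thesis
      using stable[OF that, of "Suc i - j"] by simp
  next
    case False
    have "i < N (Suc i)"
      using strict_mono_imp_increasing[OF mono, of "Suc i"] by simp
    then show ?thesis
      using stable[of i "Suc i" "j - Suc i"] False by simp
  qed
  then show thesis
    using that[of "\<lambda>i. b (Suc i) i"] by simp
qed

text \<open>The hypothesis expresses openness in Baire space. Stage \<open>m\<close> of the fusion
  extends a finite stem so that no continuation with values at least \<open>m\<close> lies in the
  \<open>m\<close>-th intersection. The union of the stems tends to infinity but avoids every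
  intersection.\<close>

lemma tendsto_infinity_not_Union_Inter_open:
  fixes G :: "nat \<Rightarrow> nat \<Rightarrow> (nat \<Rightarrow> nat) set"
  assumes op: "\<And>m j a. a \<in> G m j \<Longrightarrow> \<exists>N. \<forall>b. (\<forall>i<N. b i = a i) \<longrightarrow> b \<in> G m j"
  shows "(\<Union>m. \<Inter>j. G m j) \<noteq> {a. filterlim a at_top sequentially}"
proof
  assume eq: "(\<Union>m. \<Inter>j. G m j) = {a. filterlim a at_top sequentially}"
  \<comment> \<open>A pair of a sequence and a length stands for a finite stem; only the values
    below the length matter. \<open>R k\<close> is proper extension of stems by values at least
    \<open>k\<close>, and \<open>cyl k\<close> collects the infinite extensions of this
    kind.\<close>
  define R where "R k s t \<longleftrightarrow> snd s < snd t \<and> (\<forall>i<snd s. fst t i = fst s i)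
      \<and> (\<forall>i. snd s \<le> i \<and> i < snd t \<longrightarrow> k \<le> fst t i)"
    for k :: nat and s t :: "(nat \<Rightarrow> nat) \<times> nat"
  define cyl where "cyl k s = {c. (\<forall>i<snd s. c i = fst s i) \<and> (\<forall>i\<ge>snd s. k \<le> c i)}"
    for k :: nat and s :: "(nat \<Rightarrow> nat) \<times> nat"
  \<comment> \<open>Otherwise a point of the \<open>G\<^sub>\<delta>\<close> set taking the value \<open>k\<close> infinitely often can be built.\<close>
  have step: "\<exists>t. R k s t \<and> cyl k t \<inter> (\<Inter>j. G m j) = {}" for k m s
  proof (rule ccontr)
    assume "\<not> ?thesis"
    then have dense: "\<exists>c. c \<in> cyl k t \<and> (\<forall>j. c \<in> G m j)" if "R k s t" for t
      using that by blast
    have "\<exists>f. \<forall>n. R k s (f n) \<and> (R k (f n) (f (Suc n)) \<and> fst (f (Suc n)) (snd (f n)) = k \<and>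
        (\<forall>b. (\<forall>i<snd (f (Suc n)). b i = fst (f (Suc n)) i) \<longrightarrow> b \<in> G m n))"
    proof (rule dependent_nat_choice)
      show "\<exists>t. R k s t"
        by (rule exI[of _ "((fst s)(snd s := k), Suc (snd s))"]) (auto simp: R_def less_Suc_eq)
    next
      fix t n
      assume t: "R k s t"
      \<comment> \<open>Appending \<open>k\<close> obstructs divergence; a prefix of length at least
        \<open>L\<close> of a point \<open>c\<close> beyond \<open>?t\<close> then forces membership
        in \<open>G m n\<close>.\<close>
      let ?t = "((fst t)(snd t := k), Suc (snd t))"
      have "R k s ?t"
        using t by (auto simp: R_def less_Suc_eq)
      then obtain c where c: "c \<in> cyl k ?t" and cG: "\<And>j. c \<in> G m j"
        using dense by blast
      obtain L where L: "\<And>b. (\<forall>i<L. b i = c i) \<Longrightarrow> b \<in> G m n"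
        using op[OF cG] by blast
      have k: "c (snd t) = k" and "\<And>i. i < snd t \<Longrightarrow> c i = fst t i"
        using c by (auto simp: cyl_def)
      moreover have "k \<le> c i" if "snd s \<le> i" for i
        using that k c t by (cases "i < snd t"; cases "i = snd t") (auto simp: cyl_def R_def)
      ultimately show "\<exists>t'. R k s t' \<and> (R k t t' \<and> fst t' (snd t) = k \<and>
          (\<forall>b. (\<forall>i<snd t'. b i = fst t' i) \<longrightarrow> b \<in> G m n))"
        using t L by (intro exI[of _ "(c, max (Suc (snd t)) L)"]) (auto simp: R_def)
    qed
    then obtain f where f: "\<And>n. R k (f n) (f (Suc n))" "\<And>n. fst (f (Suc n)) (snd (f n)) = k"
      "\<And>n b. (\<forall>i<snd (f (Suc n)). b i = fst (f (Suc n)) i) \<Longrightarrow> b \<in> G m n"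
      by blast
    have less: "snd (f n) < snd (f (Suc n))" for n
      using f(1) by (simp add: R_def)
    obtain d where d: "\<And>j i. i < snd (f j) \<Longrightarrow> d i = fst (f j) i"
      by (rule coherent_limit[of "\<lambda>n. snd (f n)" "\<lambda>n. fst (f n)"])
        (use f(1) in \<open>auto simp: R_def\<close>)
    have "\<And>j. d \<in> G m j"
      using f(3) d by blast
    then have "filterlim d at_top sequentially"
      using eq by blast
    moreover have "filterlim (\<lambda>n. snd (f n)) at_top sequentially"
      using less by (intro filterlim_subseq) (simp add: strict_mono_Suc_iff)
    ultimately have "filterlim (\<lambda>n. d (snd (f n))) at_top sequentially"
      by (rule filterlim_compose)
    moreover have "d (snd (f n)) = k" for n
      using d[OF less] f(2) by simp
    ultimately show False
      by (simp add: filterlim_at_top) (metis Suc_n_not_le_n)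
  qed
  have "\<exists>f. \<forall>m. True \<and> (R m (f m) (f (Suc m)) \<and> cyl m (f (Suc m)) \<inter> (\<Inter>j. G m j) = {})"
    by (rule dependent_nat_choice) (use step in auto)
  then obtain f where f: "\<And>m. R m (f m) (f (Suc m))"
    "\<And>m. cyl m (f (Suc m)) \<inter> (\<Inter>j. G m j) = {}"
    by blast
  have less: "snd (f n) < snd (f (Suc n))" for n
    using f(1) by (simp add: R_def)
  obtain d where d: "\<And>j i. i < snd (f j) \<Longrightarrow> d i = fst (f j) i"
    by (rule coherent_limit[of "\<lambda>n. snd (f n)" "\<lambda>n. fst (f n)"])
      (use f(1) in \<open>auto simp: R_def\<close>)
  have sm: "strict_mono (\<lambda>n. snd (f n))"
    using less by (simp add: strict_mono_Suc_iff)
  \<comment> \<open>Stage \<open>m + j\<close> appends only values at least \<open>m + j\<close>,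
    hence at least \<open>m\<close>.\<close>
  have upto: "m \<le> d i" if "snd (f m) \<le> i" "i < snd (f (m + j))" for m i j
    using that(2)
  proof (induction j)
    case (Suc j)
    show ?case
    proof (cases "i < snd (f (m + j))")
      case False
      then have "m + j \<le> fst (f (Suc (m + j))) i"
        using f(1)[of "m + j"] Suc.prems by (auto simp: R_def)
      then show ?thesis
        using d[of i "Suc (m + j)"] Suc.prems by simp
    qed (use Suc.IH in simp)
  qed (use that(1) in simp)
  have large: "m \<le> d i" if "snd (f m) \<le> i" for m i
  proof (rule upto[OF that])
    show "i < snd (f (m + Suc i))"
      using strict_mono_imp_increasing[OF sm, of "m + Suc i"] by simp
  qed
  have "filterlim d at_top sequentially"
    using large by (auto simp: filterlim_at_top eventually_sequentially)
  then obtain m where "d \<in> (\<Inter>j. G m j)"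
    using eq by blast
  moreover have "d \<in> cyl m (f (Suc m))"
    using d large[of m] less[of m] by (auto simp: cyl_def)
  ultimately show False
    using f(2) by blast
qed

section \<open>Series and upper density\<close>

lemma summable_divergent_multiplier:
  fixes a :: "nat \<Rightarrow> real"
  assumes pos: "\<And>n. 0 < a n" and "summable a"
  obtains c where "\<And>n. 0 < c n" "filterlim c at_top sequentially" "summable (\<lambda>n. c n * a n)"
proof -
  \<comment> \<open>With tails \<open>r\<close>, the terms \<open>a n / sqrt (r n)\<close> are at most \<open>2 * (sqrt (r n) - sqrt (r (n + 1)))\<close>.\<close>
  define r where "r n = (\<Sum>k. a (k + n))" for n
  have sa: "summable (\<lambda>k. a (k + n))" for n
    using assms(2) by (simp add: summable_iff_shift)
  have rpos: "0 < r n" for n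
    unfolding r_def using sa pos by (intro suminf_pos) auto
  have rSuc: "r n = a n + r (Suc n)" for n
    using suminf_split_head[OF sa[of n]] by (simp add: r_def)
  have r0: "r \<longlonglongrightarrow> 0"
    unfolding r_def using suminf_exist_split2[OF assms(2)] .
  have sqrt0: "(\<lambda>n. sqrt (r n)) \<longlonglongrightarrow> 0"
    using tendsto_real_sqrt[OF r0] by simp
  show thesis
  proof (rule that[of "\<lambda>n. inverse (sqrt (r n))"])
    show "filterlim (\<lambda>n. inverse (sqrt (r n))) at_top sequentially"
      using sqrt0 rpos by (intro filterlim_inverse_at_top) auto
    have "summable (\<lambda>n. 2 * (sqrt (r n) - sqrt (r (Suc n))))"
      using telescope_summable'[OF sqrt0] by (rule summable_mult)
    moreover have "norm (inverse (sqrt (r n)) * a n) \<le> 2 * (sqrt (r n) - sqrt (r (Suc n)))" for n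
    proof -
      let ?x = "sqrt (r n)" and ?y = "sqrt (r (Suc n))"
      have x: "0 < ?x" and y: "0 < ?y" and le: "?y \<le> ?x"
        using rpos[of n] rpos[of "Suc n"] pos[of n] rSuc[of n] by simp_all
      have "a n = ?x\<^sup>2 - ?y\<^sup>2"
        using rSuc[of n] rpos[of n] rpos[of "Suc n"] by simp
      also have "\<dots> = (?x + ?y) * (?x - ?y)"
        by (simp add: power2_eq_square algebra_simps)
      also have "\<dots> \<le> (2 * ?x) * (?x - ?y)"
        using le by (intro mult_right_mono) auto
      finally show ?thesis
        using x pos[of n] by (simp add: field_simps)
    qed
    ultimately show "summable (\<lambda>n. inverse (sqrt (r n)) * a n)"
      by (rule summable_comparison_test'[of _ 0])
  qed (use rpos in simp)
qed

lemma upper_density_pos: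
  assumes "0 < \<delta>" and freq: "\<exists>\<^sub>F n in sequentially. \<delta> * real (n + 1) \<le> real (card (S \<inter> {0..<n}))"
  shows "0 < upper_density S"
proof (rule ccontr)
  assume "\<not> 0 < upper_density S"
  then have "upper_density S < ereal \<delta>"
    using assms(1) by (metis ereal_less(2) less_le_trans not_less order_le_less_trans)
  then have "\<forall>\<^sub>F n in sequentially. ereal (real (card (S \<inter> {0..<n})) / real (n + 1)) < ereal \<delta>"
    unfolding upper_density_def by (rule Limsup_lessD)
  then have "\<forall>\<^sub>F n in sequentially. \<not> \<delta> * real (n + 1) \<le> real (card (S \<inter> {0..<n}))"
    by eventually_elim (simp add: field_simps)
  then show False
    using freq by (simp add: frequently_def)
qed

text \<open>For large \<open>n\<close> the constant \<open>b\<close> costs at most half of a given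
  \<open>e * n\<close>, and a suitable \<open>k\<close> makes the other term at most the other
  half.\<close>

lemma upper_density_nonpos:
  assumes bound: "\<And>k. \<exists>b. \<forall>n. real (card (S \<inter> {0..<n})) \<le> b + real n / 2 ^ k"
  shows "upper_density S \<le> 0"
proof (rule ereal_le_epsilon2)
  fix e :: real
  assume e: "0 < e"
  obtain k where k: "(1 / 2) ^ k < e / 2"
    using real_arch_pow_inv[of "e / 2" "1 / 2"] e by auto
  obtain b where b: "\<And>n. real (card (S \<inter> {0..<n})) \<le> b + real n / 2 ^ k"
    using bound by blast
  have "\<forall>\<^sub>F n in sequentially. 2 * b / e \<le> real n"
    by (rule filterlim_real_sequentially[unfolded filterlim_at_top, rule_format])
  then have "\<forall>\<^sub>F n in sequentially. ereal (real (card (S \<inter> {0..<n})) / real (n + 1)) \<le> ereal e"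
  proof eventually_elim
    case (elim n)
    have "real n / 2 ^ k = real n * (1 / 2) ^ k"
      by (simp add: power_divide)
    also have "\<dots> \<le> real n * (e / 2)"
      using k by (intro mult_left_mono) auto
    finally have "real (card (S \<inter> {0..<n})) \<le> b + real n * (e / 2)"
      using b[of n] by linarith
    also have "\<dots> \<le> e * real (n + 1)"
      using elim e by (simp add: field_simps)
    finally show ?case
      by (simp add: field_simps)
  qed
  then show "upper_density S \<le> 0 + ereal e"
    unfolding upper_density_def by (simp add: Limsup_bounded)
qed

lemma upper_density_mono:
  assumes "S \<subseteq> T"
  shows "upper_density S \<le> upper_density T"
  unfolding upper_density_def using assms
  by (intro Limsup_mono always_eventually allI)
    (auto intro!: divide_right_mono card_mono)

section \<open>Dyadic coding of words\<close>

text \<open>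
  Write \<open>j = 2^n + t\<close> with \<open>t < 2^n\<close>, and let \<open>m = floor_log t\<close>. The place \<open>j\<close> is active if
  \<open>m + a n < n\<close> (where \<open>floor_log 0 = 0\<close>), and then it belongs to a run of \<open>2^m\<close> places carrying the
  word of index \<open>n - a n - 1 - m\<close>. Words are repeated with the period \<open>2^length\<close>, which divides
  the starting point and the length of all late runs.
\<close>

definition active :: "(nat \<Rightarrow> nat) \<Rightarrow> nat set" where
  "active a = {j. floor_log (j - 2 ^ floor_log j) + a (floor_log j) < floor_log j}"

definition word :: "nat \<Rightarrow> nat \<Rightarrow> real" where
  "word r j = (let l = from_nat r :: rat list; i = j mod 2 ^ length l
    in if i < length l then of_rat (l ! i) else 0)"

definition code :: "(nat \<Rightarrow> nat) \<Rightarrow> nat \<Rightarrow> real" where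
  "code a j = (if j \<in> active a
    then word (floor_log j - a (floor_log j) - 1 - floor_log (j - 2 ^ floor_log j)) j else 0)"

text \<open>Place \<open>j\<close> consults \<open>a\<close> only at \<open>floor_log j\<close>,
  which is at most \<open>j\<close>. This is what makes the reduction continuous.\<close>

lemma code_cong:
  assumes "\<And>i. i \<le> j \<Longrightarrow> a i = b i"
  shows "code a j = code b j"
proof -
  have "floor_log j \<le> j"
    by (cases "j = 0") (auto intro: order_trans[OF less_imp_le[OF less_exp] floor_log_exp2_le])
  then show ?thesis
    using assms by (simp add: code_def active_def)
qed

text \<open>An active offset \<open>t\<close> satisfies \<open>t < 2 ^ Suc (floor_log t)\<close>,
  and this power is at most \<open>2 ^ (n - a n)\<close>. The case \<open>n < a n\<close> is
  separate because truncated subtraction would leave one place, too many for the density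
  bound.\<close>

lemma active_block:
  "active a \<inter> {2 ^ n..<2 ^ Suc n} \<subseteq> (if a n \<le> n then (+) (2 ^ n) ` {..<2 ^ (n - a n)} else {})"
proof
  fix j
  assume j: "j \<in> active a \<inter> {2 ^ n..<2 ^ Suc n}"
  have n: "floor_log j = n"
    by (rule floor_log_eqI) (use j in \<open>auto intro: less_le_trans[of 0 "2 ^ n"]\<close>)
  define t where "t = j - 2 ^ n"
  have m: "floor_log t + a n < n"
    using j n by (simp add: active_def t_def)
  have "t < 2 ^ Suc (floor_log t)"
    using floor_log_exp2_gt[of t] by simp
  also have "\<dots> \<le> 2 ^ (n - a n)"
    using m by (intro power_increasing) auto
  finally have "t < 2 ^ (n - a n)" .
  moreover have "j = 2 ^ n + t"
    using j by (simp add: t_def)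
  ultimately show "j \<in> (if a n \<le> n then (+) (2 ^ n) ` {..<2 ^ (n - a n)} else {})"
    using m by auto
qed

lemma card_active_block:
  assumes "K \<le> a n"
  shows "real (card (active a \<inter> {2 ^ n..<2 ^ Suc n})) \<le> 2 ^ n / 2 ^ K"
proof (cases "a n \<le> n")
  case True
  have "card (active a \<inter> {2 ^ n..<2 ^ Suc n}) \<le> card ((+) (2 ^ n) ` {..<(2::nat) ^ (n - a n)})"
    using active_block[of a n] True by (intro card_mono) auto
  also have "\<dots> \<le> 2 ^ (n - a n)"
    using card_image_le[of "{..<(2::nat) ^ (n - a n)}"] by simp
  also have "\<dots> \<le> 2 ^ (n - K)"
    using assms by (intro power_increasing) auto
  finally have "real (card (active a \<inter> {2 ^ n..<2 ^ Suc n})) \<le> real (2 ^ (n - K))"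
    by (simp only: of_nat_le_iff)
  also have "\<dots> = 2 ^ n / 2 ^ K"
    using power_diff[of "2::real" K n] assms True by simp
  finally show ?thesis .
next
  case False
  then show ?thesis
    using active_block[of a n] by simp
qed

lemma upper_density_active:
  assumes "filterlim a at_top sequentially"
  shows "upper_density (active a) \<le> 0"
proof (rule upper_density_nonpos)
  fix k
  \<comment> \<open>\<open>Suc k\<close> instead of \<open>k\<close> pays for the factor 2 lost when
    \<open>N\<close> is rounded up to a power of two.\<close>
  obtain n0 where n0: "\<And>n. n0 \<le> n \<Longrightarrow> Suc k \<le> a n"
    using assms unfolding filterlim_at_top eventually_sequentially by blast
  \<comment> \<open>The term \<open>2 ^ n0\<close> absorbs all blocks before \<open>n0\<close>; the
    later ones add up geometrically.\<close>
  have dyadic: "real (card (active a \<inter> {0..<2 ^ n})) \<le> 2 ^ n0 + 2 ^ n / 2 ^ Suc k" for n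
  proof (induction n)
    case 0
    have "card (active a \<inter> {0..<2 ^ 0}) \<le> card {0..<1::nat}"
      by (intro card_mono) auto
    then have "real (card (active a \<inter> {0..<2 ^ 0})) \<le> 1"
      by simp
    also have "(1::real) \<le> 2 ^ n0 + 2 ^ 0 / 2 ^ Suc k"
      by (intro add_increasing2) auto
    finally show ?case .
  next
    case (Suc n)
    show ?case
    proof (cases "n0 \<le> n")
      case True
      have split: "active a \<inter> {0..<2 ^ Suc n} =
          active a \<inter> {0..<2 ^ n} \<union> active a \<inter> {2 ^ n..<2 ^ Suc n}"
        by auto
      have "card (active a \<inter> {0..<2 ^ Suc n}) \<le>
          card (active a \<inter> {0..<2 ^ n}) + card (active a \<inter> {2 ^ n..<2 ^ Suc n})"
        unfolding split by (rule card_Un_le)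
      then have "real (card (active a \<inter> {0..<2 ^ Suc n})) \<le>
          real (card (active a \<inter> {0..<2 ^ n})) + real (card (active a \<inter> {2 ^ n..<2 ^ Suc n}))"
        by linarith
      also have "\<dots> \<le> (2 ^ n0 + 2 ^ n / 2 ^ Suc k) + 2 ^ n / 2 ^ Suc k"
        using Suc card_active_block[where K = "Suc k" and a = a and n = n] n0[OF True] by (intro add_mono) auto
      also have "\<dots> = 2 ^ n0 + 2 ^ Suc n / 2 ^ Suc k"
        by (simp add: field_simps)
      finally show ?thesis .
    next
      case False
      have "card (active a \<inter> {0..<2 ^ Suc n}) \<le> card {0..<(2::nat) ^ Suc n}"
        by (intro card_mono) auto
      then have "real (card (active a \<inter> {0..<2 ^ Suc n})) \<le> 2 ^ Suc n"
        using of_nat_mono by fastforce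
      also have "\<dots> \<le> (2::real) ^ n0"
        using False by (intro power_increasing) auto
      also have "\<dots> \<le> 2 ^ n0 + 2 ^ Suc n / 2 ^ Suc k"
        by simp
      finally show ?thesis .
    qed
  qed
  show "\<exists>b. \<forall>n. real (card (active a \<inter> {0..<n})) \<le> b + real n / 2 ^ k"
  proof (intro exI allI)
    fix N
    show "real (card (active a \<inter> {0..<N})) \<le> 2 ^ n0 + real N / 2 ^ k"
    proof (cases "N = 0")
      case False
      define n where "n = floor_log N"
      have N: "2 ^ n \<le> N" "N < 2 ^ Suc n"
        using floor_log_exp2_le[of N] floor_log_exp2_gt[of N] False by (auto simp: n_def)
      have "real (card (active a \<inter> {0..<N})) \<le> real (card (active a \<inter> {0..<2 ^ Suc n}))"
        using N(2) by (intro of_nat_mono card_mono) auto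
      also have "\<dots> \<le> 2 ^ n0 + 2 ^ n / 2 ^ k"
        using dyadic[of "Suc n"] by simp
      also have "\<dots> \<le> 2 ^ n0 + real N / 2 ^ k"
        using N(1) by (intro add_left_mono divide_right_mono) (simp_all flip: of_nat_le_iff)
      finally show ?thesis .
    qed simp
  qed
qed

text \<open>Solving the index formula for the run: word \<open>r\<close> fills the
  \<open>2 ^ m\<close> places from \<open>2 ^ n + 2 ^ m\<close> on, a proportion
  \<open>1 / 2 ^ (a n + r + 1)\<close> of the block.\<close>

lemma code_run:
  assumes m: "m = n - a n - 1 - r" and an: "a n + r < n"
    and j: "2 ^ n + 2 ^ m \<le> j" "j < 2 ^ n + 2 * 2 ^ m"
  shows "code a j = word r j"
proof -
  have "2 * 2 ^ m \<le> (2::nat) ^ n"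
    using an m by (simp flip: power_Suc)
  then have n: "floor_log j = n"
    using j by (intro floor_log_eqI) auto
  have fm: "floor_log (j - 2 ^ n) = m"
  proof (rule floor_log_eqI)
    show "0 < j - 2 ^ n"
      using j(1) zero_less_power[of "2::nat" m] by linarith
  qed (use j in linarith)+
  have "j \<in> active a"
    using n fm an m by (simp add: active_def)
  moreover have "n - a n - 1 - m = r"
    using an m by simp
  ultimately show ?thesis
    unfolding code_def n fm by simp
qed

text \<open>For infinitely many \<open>n\<close> the value \<open>a n\<close> stays below a fixed
  \<open>K\<close>, so the run of the word \<open>l\<close> is a fixed proportion of block
  \<open>n\<close> at least, and \<open>l\<close> starts anew at every multiple of
  \<open>2 ^ length l\<close> in it.\<close>

lemma code_hits:
  fixes l :: "rat list"
  assumes nlim: "\<not> filterlim a at_top sequentially"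
  shows "0 < upper_density {N. N0 \<le> N \<and> (\<forall>i<length l. code a (N + i) = of_rat (l ! i))}"
    (is "0 < upper_density ?S")
proof -
  let ?e = "length l"
  obtain K where K: "\<exists>\<^sub>F n in sequentially. a n \<le> K"
  proof -
    obtain Z where "\<exists>\<^sub>F n in sequentially. \<not> Z \<le> a n"
      using nlim by (auto simp: filterlim_at_top not_eventually)
    then have "\<exists>\<^sub>F n in sequentially. a n \<le> Z"
      by (rule frequently_elim1) simp
    then show thesis
      by (rule that)
  qed
  define r where "r = to_nat l"
  \<comment> \<open>\<open>K + r + 1\<close> bounds the loss from block to run, \<open>?e\<close> is
    the loss from the period, and 2 comes from
    \<open>2 ^ Suc n + 1 \<le> 2 ^ (n + 2)\<close>.\<close>
  define D where "D = K + r + ?e + 3"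
  define \<delta> :: real where "\<delta> = 1 / 2 ^ D"
  show ?thesis
  proof (rule upper_density_pos)
    show "0 < \<delta>"
      by (simp add: \<delta>_def)
    show "\<exists>\<^sub>F n in sequentially. \<delta> * real (n + 1) \<le> real (card (?S \<inter> {0..<n}))"
      unfolding frequently_sequentially
    proof
      fix M
      \<comment> \<open>A large \<open>n\<close> leaves room for the word in its run and puts the
        run beyond \<open>N0\<close> and the end of the block beyond \<open>M\<close>.\<close>
      obtain n where n: "M + N0 + K + r + ?e + 3 \<le> n" "a n \<le> K"
        using K unfolding frequently_sequentially by blast
      define m where "m = n - a n - 1 - r"
      have em: "?e \<le> m" and mn: "n \<le> m + (K + r + 1)" and an: "a n + r < n"
        and mn': "Suc m \<le> n"
        using n by (auto simp: m_def)
      have big: "n < 2 ^ n"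
        by (rule less_exp)
      have m2: "2 * 2 ^ m \<le> (2::nat) ^ n"
        using mn' by (metis power_Suc power_increasing one_le_numeral)
      define start where "start i = 2 ^ n + 2 ^ m + i * 2 ^ ?e" for i :: nat
      have sub: "start ` {..<2 ^ (m - ?e)} \<subseteq> ?S \<inter> {0..<2 ^ Suc n}"
      proof (intro subsetI)
        fix N
        assume "N \<in> start ` {..<2 ^ (m - ?e)}"
        then obtain i where i: "i < 2 ^ (m - ?e)" and N: "N = start i"
          by blast
        have "Suc i * 2 ^ ?e \<le> 2 ^ (m - ?e) * 2 ^ ?e"
          using i by (intro mult_right_mono) auto
        also have "\<dots> = 2 ^ m"
          using em by (simp flip: power_add)
        finally have i2: "i * 2 ^ ?e + 2 ^ ?e \<le> 2 ^ m"
          by simp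
        have hit: "code a (N + q) = of_rat (l ! q)" if q: "q < ?e" for q
        proof -
          have q2: "q < 2 ^ ?e"
            using q less_exp[of ?e] by linarith
          have "(2::nat) ^ ?e dvd 2 ^ n" "(2::nat) ^ ?e dvd 2 ^ m"
            using em mn' by (auto intro: le_imp_power_dvd)
          then have "2 ^ ?e dvd start i"
            unfolding start_def by (intro dvd_add) auto
          then have mod: "(N + q) mod 2 ^ ?e = q"
            using q2 N by (metis add.commute dvd_imp_mod_0 mod_add_right_eq add_0_right mod_less)
          have "code a (N + q) = word r (N + q)"
            by (rule code_run[where m = m and n = n and a = a and r = r, OF m_def an]) (use q2 i2 N in \<open>auto simp: start_def\<close>)
          also have "\<dots> = of_rat (l ! q)"
            using mod q by (simp add: word_def r_def Let_def)
          finally show ?thesis .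
        qed
        have "N < 2 ^ Suc n"
          using i2 m2 N zero_less_power[of "2::nat" ?e] unfolding start_def power_Suc by linarith
        moreover have "N0 \<le> N"
          using n(1) big N unfolding start_def by linarith
        ultimately show "N \<in> ?S \<inter> {0..<2 ^ Suc n}"
          using hit by simp
      qed
      have "inj_on start {..<2 ^ (m - ?e)}"
        by (auto simp: inj_on_def start_def)
      then have "2 ^ (m - ?e) \<le> card (?S \<inter> {0..<2 ^ Suc n})"
        using card_mono[OF _ sub] by (simp add: card_image)
      then have "real (2 ^ (m - ?e)) \<le> real (card (?S \<inter> {0..<2 ^ Suc n}))"
        by (simp only: of_nat_le_iff)
      then have "2 ^ (m - ?e) \<le> real (card (?S \<inter> {0..<2 ^ Suc n}))"
        by (simp only: of_nat_power of_nat_numeral)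
      moreover have "\<delta> * real (2 ^ Suc n + 1) \<le> 2 ^ (m - ?e)"
      proof -
        have "(2::nat) ^ Suc n + 1 \<le> 2 ^ (n + 2)"
          using big by simp
        then have "real (2 ^ Suc n + 1) \<le> 2 ^ (n + 2)"
          by (metis of_nat_le_iff of_nat_numeral of_nat_power)
        also have "\<dots> \<le> 2 ^ (D + (m - ?e))"
          using mn em by (intro power_increasing) (auto simp: D_def)
        also have "\<dots> = 2 ^ (m - ?e) * 2 ^ D"
          by (simp add: power_add)
        finally show ?thesis
          by (simp add: \<delta>_def divide_le_eq)
      qed
      ultimately have "\<delta> * real (2 ^ Suc n + 1) \<le> real (card (?S \<inter> {0..<2 ^ Suc n}))"
        by linarith
      moreover have "M \<le> 2 ^ Suc n"
        using n(1) big unfolding power_Suc by linarith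
      ultimately show "\<exists>n\<ge>M. \<delta> * real (n + 1) \<le> real (card (?S \<inter> {0..<n}))"
        by blast
    qed
  qed
qed

section \<open>Borel classes and the product topology\<close>

lemma fsigmadelta_in_closed_seq:
  assumes "fsigmadelta_in X S"
  shows "\<exists>C :: nat \<Rightarrow> nat \<Rightarrow> 'a set.
    (\<forall>m j. closedin X (C m j)) \<and> S = topspace X \<inter> (\<Inter>m. \<Union>j. C m j)"
proof -
  obtain \<U> where \<U>: "countable \<U>" "\<And>F. F \<in> \<U> \<Longrightarrow> fsigma_in X F" "S = topspace X \<inter> \<Inter>\<U>"
    using assms unfolding fsigmadelta_in_def relative_to_def intersection_of_def by blast
  \<comment> \<open>\<open>from_nat_into\<close> enumerates nonempty countable families. Inserting
    \<open>topspace X\<close> here and \<open>{}\<close> below ensures nonemptiness without changing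
    the relative intersection or the union.\<close>
  define V where "V = from_nat_into (insert (topspace X) \<U>)"
  have rV: "range V = insert (topspace X) \<U>"
    unfolding V_def using \<U>(1) by (intro range_from_nat_into) auto
  have "\<exists>D :: nat \<Rightarrow> 'a set. (\<forall>j. closedin X (D j)) \<and> V m = (\<Union>j. D j)" for m
  proof -
    have "fsigma_in X (V m)"
      using rV \<U>(2) by (metis fsigma_in_topspace insert_iff rangeI)
    then have "\<exists>\<C>. countable \<C> \<and> \<C> \<subseteq> Collect (closedin X) \<and> \<Union>\<C> = V m"
      by (simp only: fsigma_in_def union_of_def)
    then obtain \<C> where \<C>: "countable \<C>" "\<C> \<subseteq> Collect (closedin X)" "\<Union>\<C> = V m"
      by (elim exE conjE)
    define D where "D = from_nat_into (insert {} \<C>)"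
    have rD: "range D = insert {} \<C>"
      unfolding D_def using \<C>(1) by (intro range_from_nat_into) auto
    have "closedin X (D j)" for j
    proof -
      have "D j \<in> insert {} \<C>"
        unfolding rD[symmetric] by (rule rangeI)
      then show ?thesis
        using \<C>(2) by auto
    qed
    moreover have "V m = (\<Union>j. D j)"
      unfolding rD using \<C>(3) by simp
    ultimately show ?thesis
      by blast
  qed
  then obtain C :: "nat \<Rightarrow> nat \<Rightarrow> 'a set"
    where C: "\<And>m j. closedin X (C m j)" "\<And>m. V m = (\<Union>j. C m j)"
    by metis
  have "S = topspace X \<inter> \<Inter>(range V)"
    using \<U>(3) rV by simp
  then show ?thesis
    using C by (intro exI[of _ C]) auto
qed

text \<open>Open sets of a metrizable space are countable unions of closed sets.\<close>

lemma gdelta_in_imp_fsigmadelta_in: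
  assumes "metrizable_space X" "gdelta_in X S"
  shows "fsigmadelta_in X S"
  using assms unfolding gdelta_in_def fsigmadelta_in_def relative_to_def intersection_of_def
  by (metis (mono_tags, lifting) Ball_Collect mem_Collect_eq open_imp_fsigma_in)

lemma metrizable_ell_prod_topology: "metrizable_space (ell_prod_topology p)"
  unfolding ell_prod_topology_def
  by (intro metrizable_space_subtopology)
    (simp add: metrizable_space_product_topology metrizable_space_euclidean)

lemma topspace_ell [simp]: "topspace (ell_prod_topology p) = ell p"
  by (simp add: ell_prod_topology_def)

lemma openin_ell_coord:
  assumes "open V"
  shows "openin (ell_prod_topology p) {x \<in> ell p. x i \<in> V}"
proof -
  have "continuous_map (ell_prod_topology p) euclideanreal (\<lambda>x. x i)"
    unfolding ell_prod_topology_def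
    by (intro continuous_map_from_subtopology continuous_map_product_projection) simp
  then show ?thesis
    using openin_continuous_map_preimage[of "ell_prod_topology p" euclideanreal "\<lambda>x. x i" V] assms
    by simp
qed

lemma openin_ell_box:
  assumes "openin (ell_prod_topology p) U" "y \<in> U"
  shows "\<exists>d. \<exists>\<epsilon>>0. \<forall>x\<in>ell p. (\<forall>i<d. \<bar>x i - y i\<bar> < \<epsilon>) \<longrightarrow> x \<in> U"
proof -
  obtain V where V: "openin (product_topology (\<lambda>_. euclideanreal) UNIV) V" "U = V \<inter> ell p"
    using assms(1) unfolding ell_prod_topology_def openin_subtopology by blast
  then obtain W where W: "finite {i. W i \<noteq> (UNIV :: real set)}" "\<And>i. open (W i)"
    "y \<in> Pi\<^sub>E UNIV W" "Pi\<^sub>E UNIV W \<subseteq> V"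
    using assms(2) by (auto simp: openin_product_topology_alt)
  obtain d where d: "\<And>i. W i \<noteq> UNIV \<Longrightarrow> i < d"
    using finite_nat_bounded[OF W(1)] by auto
  have "\<exists>\<epsilon>>0. \<forall>z. \<bar>z - y i\<bar> < \<epsilon> \<longrightarrow> z \<in> W i" for i
    using W(2)[of i] W(3) by (auto simp: open_dist dist_real_def PiE_iff)
  then obtain \<epsilon> where \<epsilon>: "\<And>i. 0 < \<epsilon> i" "\<And>i z. \<bar>z - y i\<bar> < \<epsilon> i \<Longrightarrow> z \<in> W i"
    by metis
  \<comment> \<open>Inserting 1 keeps the set nonempty when \<open>d = 0\<close>.\<close>
  define e where "e = Min (insert 1 (\<epsilon> ` {..<d}))"
  show ?thesis
  proof (intro exI conjI ballI impI)
    show "0 < e"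
      using \<epsilon>(1) by (auto simp: e_def)
    fix x
    assume x: "x \<in> ell p" "\<forall>i<d. \<bar>x i - y i\<bar> < e"
    have "x i \<in> W i" for i
    proof (cases "i < d")
      case True
      then have "e \<le> \<epsilon> i"
        by (auto simp: e_def intro: Min_le)
      then show ?thesis
        using x(2) True \<epsilon>(2) by fastforce
    next
      case False
      then show ?thesis
        using d by auto
    qed
    then show "x \<in> U"
      using W(4) V(2) x(1) by (auto simp: PiE_iff)
  qed
qed

lemma weighted_shift_in_ell:
  assumes "bounded (range w)" "0 \<le> p" "x \<in> ell p"
  shows "weighted_shift w x \<in> ell p"
proof -
  obtain M where M: "\<And>n. \<bar>w n\<bar> \<le> M"
    using assms(1) by (auto simp: bounded_iff)
  have "summable (\<lambda>n. \<bar>x (Suc n)\<bar> powr p)"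
    using assms(3) by (simp add: ell_def summable_Suc_iff[of "\<lambda>n. \<bar>x n\<bar> powr p"])
  then have "summable (\<lambda>n. M powr p * \<bar>x (Suc n)\<bar> powr p)"
    by (rule summable_mult)
  moreover have "norm (\<bar>weighted_shift w x n\<bar> powr p) \<le> M powr p * \<bar>x (Suc n)\<bar> powr p" for n
    using powr_mono2[OF assms(2) _ M[of "Suc n"]]
    by (auto simp: weighted_shift_def abs_mult powr_mult intro: mult_right_mono)
  ultimately show ?thesis
    unfolding ell_def mem_Collect_eq by (rule summable_comparison_test'[of _ 0])
qed

text \<open>Scaling coordinate \<open>i\<close> by \<open>prod w {..i}\<close> conjugates the
  weighted shift to the unweighted one.\<close>

lemma weighted_shift_funpow:
  "prod w {..i} * (weighted_shift w ^^ n) x i = prod w {..n + i} * x (n + i)"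
  for w :: "nat \<Rightarrow> real"
proof (induction n arbitrary: i)
  case (Suc n)
  have "prod w {..i} * (weighted_shift w ^^ Suc n) x i =
      prod w {..Suc i} * (weighted_shift w ^^ n) x (Suc i)"
    by (simp add: weighted_shift_def)
  also have "\<dots> = prod w {..n + Suc i} * x (n + Suc i)"
    by (rule Suc)
  finally show ?case
    by (simp only: add_Suc_right add_Suc)
qed simp

section \<open>Continuous reduction to upper frequent hypercyclicity\<close>

lemma UFHC_weighted_shift_not_fsigmadelta:
  fixes w :: "nat \<Rightarrow> real"
  assumes p: "0 < p" and bdd: "bounded (range w)" and w: "\<And>n. 0 < w n"
    and sum: "summable (\<lambda>n. 1 / (\<Prod>i\<le>n. w i) powr p)"
  shows "\<not> fsigmadelta_in (ell_prod_topology p) (UFHC (ell_prod_topology p) (weighted_shift w))"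
proof
  let ?X = "ell_prod_topology p" and ?T = "weighted_shift w"
  assume fs: "fsigmadelta_in ?X (UFHC ?X ?T)"
  obtain C :: "nat \<Rightarrow> nat \<Rightarrow> (nat \<Rightarrow> real) set" where C: "\<And>m j. closedin ?X (C m j)"
    and UFHC: "UFHC ?X ?T = ell p \<inter> (\<Inter>m. \<Union>j. C m j)"
    using fsigmadelta_in_closed_seq[OF fs] unfolding topspace_ell by blast
  define P where "P n = prod w {..n}" for n
  have P: "0 < P n" for n
    using w by (simp add: P_def prod_pos)
  have inv_pos: "0 < 1 / P n powr p" for n
    using P[of n] by simp
  have inv_sum: "summable (\<lambda>n. 1 / P n powr p)"
    using sum by (simp only: P_def)
  obtain c where cpos: "\<And>n. 0 < c n" and clim: "filterlim c at_top sequentially"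
    and csum: "summable (\<lambda>n. c n * (1 / P n powr p))"
    by (rule summable_divergent_multiplier[OF inv_pos inv_sum]) blast
  \<comment> \<open>The cutoff bounds \<open>\<bar>\<Phi> a n\<bar> powr p\<close> by the summable
    \<open>c n / P n powr p\<close>. As \<open>c\<close> does not depend on \<open>a\<close>, it
    preserves continuity.\<close>
  define u where "u a n = (if \<bar>code a n\<bar> powr p \<le> c n then code a n else 0)" for a n
  define \<Phi> where "\<Phi> a n = u a n / P n" for a n
  have \<Phi>_ell: "\<Phi> a \<in> ell p" for a
    unfolding ell_def mem_Collect_eq
  proof (rule summable_comparison_test'[of _ 0, OF csum])
    fix n
    have "\<bar>u a n\<bar> powr p \<le> c n"
      using cpos[of n] p by (simp add: u_def)
    then show "norm (\<bar>\<Phi> a n\<bar> powr p) \<le> c n * (1 / P n powr p)"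
      using P[of n] by (simp add: \<Phi>_def abs_div powr_divide divide_right_mono)
  qed
  have orbit_ell: "(?T ^^ n) x \<in> ell p" if "x \<in> ell p" for n x
    by (induction n) (use that p weighted_shift_in_ell[OF bdd] in auto)
  have orbit: "(?T ^^ n) (\<Phi> a) i = u a (n + i) / P i" for a n i
    using weighted_shift_funpow[of w i n "\<Phi> a"] P[of i] P[of "n + i"]
    by (simp add: \<Phi>_def field_simps flip: P_def)
  have \<Phi>_cong: "\<Phi> a n = \<Phi> b n" if "\<And>i. i \<le> n \<Longrightarrow> a i = b i" for a b n
    using code_cong[OF that] by (simp add: \<Phi>_def u_def)

  have reduction: "\<Phi> a \<in> UFHC ?X ?T \<longleftrightarrow> \<not> filterlim a at_top sequentially" for a
  proof
    assume a: "\<not> filterlim a at_top sequentially"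
    have "0 < upper_density {n. (?T ^^ n) (\<Phi> a) \<in> U}" if U: "openin ?X U" "U \<noteq> {}" for U
    proof -
      obtain y where y: "y \<in> U"
        using U(2) by blast
      obtain d \<epsilon> where \<epsilon>: "0 < \<epsilon>"
        and box: "\<forall>x\<in>ell p. (\<forall>i<d. \<bar>x i - y i\<bar> < \<epsilon>) \<longrightarrow> x \<in> U"
        using openin_ell_box[OF U(1) y] by blast
      \<comment> \<open>Orbit coordinates are letters divided by \<open>P i\<close>, so the letters
        must approximate \<open>P i * y i\<close>.\<close>
      have "\<exists>q. \<bar>real_of_rat q / P i - y i\<bar> < \<epsilon>" for i
      proof -
        have "P i * (y i - \<epsilon>) < P i * (y i + \<epsilon>)"
          using P[of i] \<epsilon> by (intro mult_strict_left_mono) auto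
        then obtain q where "P i * (y i - \<epsilon>) < real_of_rat q" "real_of_rat q < P i * (y i + \<epsilon>)"
          using of_rat_dense by blast
        then have "y i - \<epsilon> < real_of_rat q / P i" "real_of_rat q / P i < y i + \<epsilon>"
          using P[of i] by (simp_all add: field_simps)
        then show ?thesis
          by (intro exI[of _ q]) (simp add: abs_less_iff)
      qed
      then obtain q where q: "\<And>i. \<bar>real_of_rat (q i) / P i - y i\<bar> < \<epsilon>"
        by metis
      define l where "l = map q [0..<d]"
      \<comment> \<open>Once \<open>c\<close> exceeds \<open>B\<close>, the cutoff leaves the
        letters of \<open>l\<close> intact.\<close>
      define B where "B = Max (insert 0 ((\<lambda>i. \<bar>real_of_rat (q i)\<bar> powr p) ` {..<d}))"
      obtain N0 where N0: "\<And>n. N0 \<le> n \<Longrightarrow> B \<le> c n"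
        using clim unfolding filterlim_at_top eventually_sequentially by blast
      have "0 < upper_density {N. N0 \<le> N \<and> (\<forall>i<length l. code a (N + i) = of_rat (l ! i))}"
        by (rule code_hits[OF a])
      also have "\<dots> \<le> upper_density {n. (?T ^^ n) (\<Phi> a) \<in> U}"
      proof (intro upper_density_mono subsetI)
        fix N
        assume "N \<in> {N. N0 \<le> N \<and> (\<forall>i<length l. code a (N + i) = of_rat (l ! i))}"
        then have N: "N0 \<le> N" "\<And>i. i < d \<Longrightarrow> code a (N + i) = of_rat (q i)"
          by (auto simp: l_def)
        have "\<bar>(?T ^^ N) (\<Phi> a) i - y i\<bar> < \<epsilon>" if i: "i < d" for i
        proof -
          have "\<bar>real_of_rat (q i)\<bar> powr p \<le> B"
            using i by (auto simp: B_def intro: Max_ge)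
          also have "B \<le> c (N + i)"
            using N(1) by (intro N0) simp
          finally show ?thesis
            using q[of i] N(2)[OF i] by (simp add: orbit u_def)
        qed
        then show "N \<in> {n. (?T ^^ n) (\<Phi> a) \<in> U}"
          using box orbit_ell[OF \<Phi>_ell] by blast
      qed
      finally show ?thesis .
    qed
    then show "\<Phi> a \<in> UFHC ?X ?T"
      using \<Phi>_ell by (auto simp: UFHC_def)
  next
    assume a: "\<Phi> a \<in> UFHC ?X ?T"
    \<comment> \<open>The orbit can visit this open set only at active times, since
      \<open>code a\<close> vanishes elsewhere.\<close>
    let ?U = "{x \<in> ell p. x 0 \<in> {0<..}}"
    have "(\<lambda>n. if n = 0 then 1 else 0) \<in> ell p"
      unfolding ell_def mem_Collect_eq by (rule summable_finite[of "{0}"]) auto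
    then have "?U \<noteq> {}"
      by force
    then have pos: "0 < upper_density {n. (?T ^^ n) (\<Phi> a) \<in> ?U}"
      using a openin_ell_coord[of "{0<..}" p 0] by (auto simp: UFHC_def)
    have "{n. (?T ^^ n) (\<Phi> a) \<in> ?U} \<subseteq> active a"
      using P[of 0] by (auto simp: orbit u_def code_def split: if_splits)
    then show "\<not> filterlim a at_top sequentially"
      using upper_density_mono upper_density_active pos by (meson less_le_trans not_less)
  qed

  \<comment> \<open>By De Morgan, the complement of the preimage of \<open>UFHC\<close> under
    \<open>\<Phi>\<close> is a countable union of countable intersections of these sets. They are
    open because the first \<open>d\<close> coordinates of \<open>\<Phi> a\<close> depend only on
    the first \<open>d\<close> values of \<open>a\<close>.\<close>
  define G where "G m j = {a. \<Phi> a \<notin> C m j}" for m j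
  have "\<exists>N. \<forall>b. (\<forall>i<N. b i = a i) \<longrightarrow> b \<in> G m j" if a: "a \<in> G m j" for m j a
  proof -
    have op: "openin ?X (ell p - C m j)" and mem: "\<Phi> a \<in> ell p - C m j"
      using C[of m j] a \<Phi>_ell by (auto simp: G_def closedin_def)
    obtain d \<epsilon> where \<epsilon>: "0 < \<epsilon>" and box: "\<forall>x\<in>ell p.
        (\<forall>i<d. \<bar>x i - \<Phi> a i\<bar> < \<epsilon>) \<longrightarrow> x \<in> ell p - C m j"
      using openin_ell_box[OF op mem] by (elim exE conjE)
    have "b \<in> G m j" if b: "\<forall>i<d. b i = a i" for b
    proof -
      have "\<Phi> b i = \<Phi> a i" if "i < d" for i
        using b that by (intro \<Phi>_cong) auto
      then show ?thesis
        using bspec[OF box \<Phi>_ell, of b] \<epsilon> by (simp add: G_def)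
    qed
    then show ?thesis
      by blast
  qed
  then have "(\<Union>m. \<Inter>j. G m j) \<noteq> {a. filterlim a at_top sequentially}"
    by (rule tendsto_infinity_not_Union_Inter_open)
  moreover have "a \<in> (\<Union>m. \<Inter>j. G m j) \<longleftrightarrow> filterlim a at_top sequentially" for a
    using reduction[of a] UFHC \<Phi>_ell[of a] by (auto simp: G_def)
  ultimately show False
    by blast
qed

theorem theorem2p1:
  fixes p :: real
  assumes "1 \<le> p"
  shows "(\<forall>w :: nat \<Rightarrow> real.
            bounded (range w) \<and> (\<forall>n. 1 \<le> w n) \<and>
            summable (\<lambda>n. 1 / (\<Prod>i\<le>n. w i) powr p) \<longrightarrow>
            \<not> fsigmadelta_in (ell_prod_topology p)
                (UFHC (ell_prod_topology p) (weighted_shift w)))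
       \<and> (\<forall>l :: real. 1 < l \<longrightarrow>
            \<not> gdelta_in (ell_prod_topology p)
                (UFHC (ell_prod_topology p) (\<lambda>x n. l * backward_shift x n)))"
proof (intro conjI allI impI)
  fix w :: "nat \<Rightarrow> real"
  assume w: "bounded (range w) \<and> (\<forall>n. 1 \<le> w n) \<and> summable (\<lambda>n. 1 / (\<Prod>i\<le>n. w i) powr p)"
  then have "0 < w n" for n
    by (meson less_le_trans zero_less_one)
  then show "\<not> fsigmadelta_in (ell_prod_topology p)
      (UFHC (ell_prod_topology p) (weighted_shift w))"
    using UFHC_weighted_shift_not_fsigmadelta[of p w] w assms by simp
next
  fix l :: real
  assume l: "1 < l"
  \<comment> \<open>The product has \<open>n + 1\<close> factors \<open>l\<close>, so the series is
    geometric with ratio \<open>\<rho>\<close>.\<close>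
  define \<rho> where "\<rho> = 1 / l powr p"
  have \<rho>: "0 < \<rho>" "\<rho> < 1"
    using l assms by (simp_all add: \<rho>_def gr_one_powr)
  have pow: "(l ^ k) powr p = (l powr p) ^ k" for k
    using l by (induction k) (simp_all add: powr_mult)
  have "1 / (\<Prod>i\<le>n. l) powr p = \<rho> * \<rho> ^ n" for n
    unfolding prod_constant card_atMost pow \<rho>_def by (simp add: power_one_over)
  moreover have "summable (\<lambda>n. \<rho> * \<rho> ^ n)"
    using \<rho> by (intro summable_mult summable_geometric) simp
  ultimately have "summable (\<lambda>n. 1 / (\<Prod>i\<le>n. l) powr p)"
    by simp
  then have "\<not> fsigmadelta_in (ell_prod_topology p)
      (UFHC (ell_prod_topology p) (weighted_shift (\<lambda>_. l)))"
    using UFHC_weighted_shift_not_fsigmadelta[of p "\<lambda>_. l"] l assms by simp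
  moreover have "(\<lambda>x n. l * backward_shift x n) = weighted_shift (\<lambda>_. l)"
    by (simp add: fun_eq_iff weighted_shift_def backward_shift_def)
  ultimately show "\<not> gdelta_in (ell_prod_topology p)
      (UFHC (ell_prod_topology p) (\<lambda>x n. l * backward_shift x n))"
    using gdelta_in_imp_fsigmadelta_in metrizable_ell_prod_topology by auto
qed

end
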